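(* Consider an $N$-player discrete-time dynamic game with dynamics $x^{(k+1)}=f^{(k)}(x^{(k)},u_1^{(k)},\dots,u_N^{(k)})$, fixed initial state $x^{(1)}=x_1$, horizon $\mathbb{K}=\{1,\dots,k_E\}$, feature counts $\mu_i(\zeta)\in\mathbb{R}^{p_i}$ and true (unknown) parameters $\theta_i^*\in\mathbb{R}^{p_i}$, $i\in\mathbb{P}=\{1,\dots,N\}$. Put $\theta_\Sigma=(\theta_1^\top,\dots,\theta_N^\top)^\top$, $\theta_\Sigma^*=(\theta_1^{*\top},\dots,\theta_N^{*\top})^\top$, $\mu_\Sigma(\zeta)=(\mu_1(\zeta)^\top,\dots,\mu_N(\zeta)^\top)^\top$ and $J_\Sigma(\zeta,\theta_\Sigma)=\sum_{i=1}^N J_i(\zeta,\theta_i)=-\theta_\Sigma^\top\mu_\Sigma(\zeta)$, and consider the family of probability densities on trajectories $$\mathrm{p}(\zeta\mid\theta_\Sigma)=\frac{\exp\left(\theta_\Sigma^\top\mu_\Sigma(\zeta)\right)}{\int \exp\left(\theta_\Sigma^\top\mu_\Sigma(\zeta')\right)\mathrm{d}\zeta'} .$$ Let $n_t\ge 1$ observed trajectories $\mathcal{D}=\{\tilde\zeta_1,\dots,\tilde\zeta_{n_t}\}$ be given such that $$\mathbb{E}_{\mathrm{p}(\zeta\mid\theta_\Sigma^* )}\{\mu_i(\zeta)\}=\frac{1}{n_t}\sum_{l=1}^{n_t}\mu_i(\tilde\zeta_l)\qquad\text{for all } i\in\mathbb{P}.$$ Let $\hat\theta_\Sigma$ be a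 maximum likelihood estimator with respect to $\mathcal{D}$, i.e. $$\hat\theta_\Sigma\in\underset{\theta_\Sigma}{\arg\max}\ \ln\prod_{l=1}^{n_t}\mathrm{p}(\tilde\zeta_l\mid\theta_\Sigma).$$ Then $$\mathbb{E}_{\mathrm{p}(\zeta\mid\theta_\Sigma^* )}\{J_\Sigma(\zeta,\theta_\Sigma^* )\}=\mathbb{E}_{\mathrm{p}(\zeta\mid\hat\theta_\Sigma)}\{J_\Sigma(\zeta,\theta_\Sigma^* )\}.$$
   Context: Setting. There are $N$ players, $\mathbb{P}=\{1,\dots,N\}$, and time steps $\mathbb{K}=\{1,\dots,k_E\}$. The state is $x^{(k)}\in\mathbb{R}^n$, the control of player $i$ is $u_i^{(k)}\in\mathbb{R}^{m_i}$. The dynamics are $x^{(k+1)}=f^{(k)}(x^{(k)},u_1^{(k)},\dots,u_N^{(k)})$ with each $f^{(k)}$ continuously differentiable in all arguments, and the initial state $x^{(1)}=x_1$ is fixed and known. Features and costs. Player $i$ has a known feature vector $\eta_i(x,u_1,\dots,u_N)\in\mathbb{R}^{p_i}$ whose components are continuously differentiable in all arguments. A trajectory $\zeta=\{\underline{x},\underline{u}_1,\dots,\underline{u}_N\}$ consists of the state values $\underline{x}=(x^{(k)})_{k\in\mathbb{K}}$ and control values $\underline{u}_i=(u_i^{(k)})_{k\in\mathbb{K}}$ that are feasible for the dynamics. The feature count is $\mu_i(\zeta)=\sum_{k=1}^{k_E}\eta_i(x^{(k)},u_1^{(k)},\dots,u_N^{(k)})\in\mathbb{R}^{p_i}$, and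 the cost of player $i$ with parameter vector $\theta_i\in\mathbb{R}^{p_i}$ is $J_i(\zeta,\theta_i)=-\theta_i^\top\mu_i(\zeta)$. Integration over trajectories. The integral $\int\cdot\,\mathrm{d}\zeta$ is over all feasible trajectories. Since the initial state is fixed, a feasible trajectory is determined by the controls $(\underline{u}_1,\dots,\underline{u}_N)\in\mathbb{R}^{k_E(m_1+\dots+m_N)}$, and $\mathrm{d}\zeta$ is understood as Lebesgue measure in these controls. Densities and expectations are with respect to this measure. Well-definedness conventions. The parameters considered (including $\theta_\Sigma^*$, and the set over which the arg max is taken) are those for which the normalizing integral is finite; the expectations of the feature counts under $\mathrm{p}(\zeta\mid\theta_\Sigma^* )$ exist and are finite; a maximizer $\hat\theta_\Sigma$ is assumed to exist. *)

theory Defs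
  imports "HOL-Analysis.Analysis"
begin

text \<open>
  The state space is \<open>real ^ 'n\<close>. The dimensions of the control and feature spaces depend on the
  player, so vectors in these spaces are functions on \<open>{1..d}\<close>, extensional where a carrier set is
  needed. A control profile \<open>v\<close> at one time step has components \<open>v i j\<close> with player \<open>i\<close> and
  coordinate \<open>j\<close>; \<open>dyn k\<close> and \<open>feat i\<close> are only ever used on profiles in \<open>stage_ctrls\<close>.
\<close>

record ('n::finite) game =
  players :: nat
  horizon :: nat
  ctrl_dim :: "nat \<Rightarrow> nat"
  feat_dim :: "nat \<Rightarrow> nat"
  dyn :: "nat \<Rightarrow> real ^ 'n \<Rightarrow> (nat \<Rightarrow> nat \<Rightarrow> real) \<Rightarrow> real ^ 'n"
  init :: "real ^ 'n"
  feat :: "nat \<Rightarrow> real ^ 'n \<Rightarrow> (nat \<Rightarrow> nat \<Rightarrow> real) \<Rightarrow> nat \<Rightarrow> real"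

definition stage_ctrls :: "'n::finite game \<Rightarrow> (nat \<Rightarrow> nat \<Rightarrow> real) set" where
  "stage_ctrls G = (\<Pi>\<^sub>E i\<in>{1..players G}. \<Pi>\<^sub>E j\<in>{1..ctrl_dim G i}. UNIV)"

text \<open>
  Continuous differentiability in all arguments: all first partial derivatives exist and are
  continuous. On \<open>stage_ctrls\<close> the product topology of the function type is the Euclidean one,
  since only finitely many coordinates vary.
\<close>

definition C1_stage ::
  "'n::finite game \<Rightarrow> (real ^ 'n \<Rightarrow> (nat \<Rightarrow> nat \<Rightarrow> real) \<Rightarrow> 'b::real_normed_vector) \<Rightarrow> bool" where
  "C1_stage G g \<longleftrightarrow>
    (\<exists>Dx Du.
      (\<forall>a. continuous_on (UNIV \<times> stage_ctrls G) (\<lambda>(x, v). Dx a x v)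
         \<and> (\<forall>x. \<forall>v\<in>stage_ctrls G.
              ((\<lambda>t. g (x + t *\<^sub>R axis a 1) v) has_vector_derivative Dx a x v) (at 0))) \<and>
      (\<forall>i\<in>{1..players G}. \<forall>j\<in>{1..ctrl_dim G i}.
         continuous_on (UNIV \<times> stage_ctrls G) (\<lambda>(x, v). Du i j x v)
         \<and> (\<forall>x. \<forall>v\<in>stage_ctrls G.
              ((\<lambda>t. g x (v(i := (v i)(j := t)))) has_vector_derivative Du i j x v) (at (v i j)))))"

definition dynamic_game :: "'n::finite game \<Rightarrow> bool" where
  "dynamic_game G \<longleftrightarrow> 1 \<le> players G \<and> 1 \<le> horizon G
    \<and> (\<forall>k\<in>{1..horizon G}. C1_stage G (dyn G k))
    \<and> (\<forall>i\<in>{1..players G}. \<forall>j\<in>{1..feat_dim G i}. C1_stage G (\<lambda>x v. feat G i x v j))"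

text \<open>
  A trajectory \<open>(x, u)\<close> has states \<open>x k\<close> and control coordinates \<open>u i k j\<close> (player, time step,
  coordinate).
\<close>

type_synonym controls = "nat \<Rightarrow> nat \<Rightarrow> nat \<Rightarrow> real"
type_synonym 'n trajectory = "(nat \<Rightarrow> real ^ 'n) \<times> controls"

definition stage :: "'n::finite game \<Rightarrow> controls \<Rightarrow> nat \<Rightarrow> nat \<Rightarrow> nat \<Rightarrow> real" where
  "stage G u k = (\<lambda>i\<in>{1..players G}. u i k)"

definition ctrl_space :: "'n::finite game \<Rightarrow> controls set" where
  "ctrl_space G =
    (\<Pi>\<^sub>E i\<in>{1..players G}. \<Pi>\<^sub>E k\<in>{1..horizon G}. \<Pi>\<^sub>E j\<in>{1..ctrl_dim G i}. UNIV)"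

definition feasible :: "'n::finite game \<Rightarrow> 'n trajectory \<Rightarrow> bool" where
  "feasible G = (\<lambda>(x, u). u \<in> ctrl_space G \<and> x \<in> extensional {1..horizon G} \<and> x 1 = init G
     \<and> (\<forall>k\<in>{1..<horizon G}. x (Suc k) = dyn G k (x k) (stage G u k)))"

text \<open>Lebesgue measure in all control coordinates.\<close>

definition ctrl_measure :: "'n::finite game \<Rightarrow> controls measure" where
  "ctrl_measure G =
    (\<Pi>\<^sub>M i\<in>{1..players G}. \<Pi>\<^sub>M k\<in>{1..horizon G}. \<Pi>\<^sub>M j\<in>{1..ctrl_dim G i}. lborel)"

text \<open>States are indexed from 1; the value at 0 is not used.\<close>

primrec state_at :: "'n::finite game \<Rightarrow> controls \<Rightarrow> nat \<Rightarrow> real ^ 'n" where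
  "state_at G u 0 = init G"
| "state_at G u (Suc k) = (if k = 0 then init G else dyn G k (state_at G u k) (stage G u k))"

definition traj :: "'n::finite game \<Rightarrow> controls \<Rightarrow> 'n trajectory" where
  "traj G u = (\<lambda>k\<in>{1..horizon G}. state_at G u k, u)"

text \<open>
  The reference measure \<open>d\<zeta>\<close>: a feasible trajectory is determined by its controls, and Lebesgue
  measure is transported along this bijection.
\<close>

definition traj_measure :: "'n::finite game \<Rightarrow> 'n trajectory measure" where
  "traj_measure G = embed_measure (ctrl_measure G) (traj G)"

lemma inj_traj: "inj (traj G)"
  by (auto simp: traj_def inj_def)

lemma space_traj_measure:
  assumes "1 \<le> horizon G"
  shows "space (traj_measure G) = {\<zeta>. feasible G \<zeta>}"
proof -
  have "feasible G (traj G u)" if "u \<in> ctrl_space G" for u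
    using that assms by (auto simp: feasible_def traj_def)
  moreover have "\<zeta> \<in> traj G ` ctrl_space G" if feas: "feasible G \<zeta>" for \<zeta>
  proof -
    obtain x u where \<zeta>: "\<zeta> = (x, u)" by (cases \<zeta>)
    have "k \<in> {1..horizon G} \<Longrightarrow> x k = state_at G u k" for k
    proof (induction k)
      case (Suc k)
      then show ?case using feas by (cases "k = 0") (auto simp: \<zeta> feasible_def)
    qed simp
    then have "x = (\<lambda>k\<in>{1..horizon G}. state_at G u k)"
      using feas by (auto simp: \<zeta> feasible_def extensional_def fun_eq_iff)
    then show ?thesis using feas by (auto simp: \<zeta> feasible_def traj_def)
  qed
  ultimately show ?thesis
    by (auto simp: traj_measure_def space_embed_measure ctrl_measure_def space_PiM ctrl_space_def)
qed

definition feature_count :: "'n::finite game \<Rightarrow> nat \<Rightarrow> 'n trajectory \<Rightarrow> nat \<Rightarrow> real" where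
  "feature_count G i = (\<lambda>(x, u) j. \<Sum>k=1..horizon G. feat G i (x k) (stage G u k) j)"

definition cost :: "'n::finite game \<Rightarrow> nat \<Rightarrow> 'n trajectory \<Rightarrow> (nat \<Rightarrow> real) \<Rightarrow> real" where
  "cost G i \<zeta> \<theta> = - (\<Sum>j=1..feat_dim G i. \<theta> j * feature_count G i \<zeta> j)"

text \<open>
  The stacked vectors \<open>\<theta>\<^sub>\<Sigma>\<close> and \<open>\<mu>\<^sub>\<Sigma>\<close> have components indexed by player and feature, so
  \<open>sum_score G \<theta> \<zeta>\<close> is \<open>\<theta>\<^sub>\<Sigma>\<^sup>T \<mu>\<^sub>\<Sigma>(\<zeta>)\<close>.
\<close>

definition sum_score :: "'n::finite game \<Rightarrow> (nat \<Rightarrow> nat \<Rightarrow> real) \<Rightarrow> 'n trajectory \<Rightarrow> real" where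
  "sum_score G \<theta> \<zeta> =
    (\<Sum>i=1..players G. \<Sum>j=1..feat_dim G i. \<theta> i j * feature_count G i \<zeta> j)"

definition sum_cost :: "'n::finite game \<Rightarrow> 'n trajectory \<Rightarrow> (nat \<Rightarrow> nat \<Rightarrow> real) \<Rightarrow> real" where
  "sum_cost G \<zeta> \<theta> = (\<Sum>i=1..players G. cost G i \<zeta> (\<theta> i))"

lemma sum_cost_eq: "sum_cost G \<zeta> \<theta> = - sum_score G \<theta> \<zeta>"
  by (simp add: sum_cost_def cost_def sum_score_def sum_negf)

text \<open>Parameters with finite normalizing integral.\<close>

definition params :: "'n::finite game \<Rightarrow> (nat \<Rightarrow> nat \<Rightarrow> real) set" where
  "params G = {\<theta> \<in> (\<Pi>\<^sub>E i\<in>{1..players G}. \<Pi>\<^sub>E j\<in>{1..feat_dim G i}. UNIV).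
     integrable (traj_measure G) (\<lambda>\<zeta>. exp (sum_score G \<theta> \<zeta>))}"

definition traj_density :: "'n::finite game \<Rightarrow> (nat \<Rightarrow> nat \<Rightarrow> real) \<Rightarrow> 'n trajectory \<Rightarrow> real" where
  "traj_density G \<theta> \<zeta> =
    exp (sum_score G \<theta> \<zeta>) / (LINT \<zeta>'|traj_measure G. exp (sum_score G \<theta> \<zeta>'))"

definition traj_dist ::
  "'n::finite game \<Rightarrow> (nat \<Rightarrow> nat \<Rightarrow> real) \<Rightarrow> 'n trajectory measure" where
  "traj_dist G \<theta> = density (traj_measure G) (\<lambda>\<zeta>. ennreal (traj_density G \<theta> \<zeta>))"

end

theory Submission
  imports Defs
begin

text \<open>
  Since the features are matched, the averaged log-likelihood of the data at \<open>\<theta>\<close> is the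
  expectation of \<open>ln p(\<zeta> | \<theta>)\<close> under \<open>p(\<zeta> | \<theta>\<^sup>*)\<close>. By Gibbs' inequality it is maximal at
  \<open>\<theta> = \<theta>\<^sup>*\<close>, and any other maximizer has the same density almost everywhere. Hence a maximum
  likelihood estimator induces the true trajectory distribution, even if the parameters differ.
\<close>

text \<open>This is the equality case of Gibbs' inequality. Hypothesis \<open>le\<close> says that
  under \<open>p\<close> the mean of \<open>ln q\<close> is at least the mean of
  \<open>ln p\<close>, so the Kullback-Leibler divergence of \<open>p\<close> from \<open>q\<close>
  is at most 0. The measure \<open>M\<close> may be infinite, as Lebesgue measure is.\<close>

lemma AE_eq_gibbs_density:
  fixes M :: "'a measure" and f g :: "'a \<Rightarrow> real"
  defines "Zf \<equiv> LINT x|M. exp (f x)" and "Zg \<equiv> LINT x|M. exp (g x)"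
  defines "p \<equiv> \<lambda>x. exp (f x) / Zf" and "q \<equiv> \<lambda>x. exp (g x) / Zg"
  assumes exp_f: "integrable M (\<lambda>x. exp (f x))" and exp_g: "integrable M (\<lambda>x. exp (g x))"
    and pos: "0 < Zf" "0 < Zg"
    and f: "integrable (density M (\<lambda>x. ennreal (p x))) f"
    and g: "integrable (density M (\<lambda>x. ennreal (p x))) g"
    and le: "(LINT x|density M (\<lambda>x. ennreal (p x)). f x) - ln Zf
      \<le> (LINT x|density M (\<lambda>x. ennreal (p x)). g x) - ln Zg"
  shows "AE x in M. p x = q x"
proof -
  have [measurable]: "f \<in> borel_measurable M" "g \<in> borel_measurable M"
    using f g by (auto dest!: borel_measurable_integrable)
  have p_pos: "0 < p x" for x
    using pos by (simp add: p_def)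
  have [measurable]: "p \<in> borel_measurable M"
    unfolding p_def by measurable
  have p: "integrable M p" and q: "integrable M q"
    using exp_f exp_g by (simp_all add: p_def q_def)
  have int_p: "integral\<^sup>L M p = 1" and int_q: "integral\<^sup>L M q = 1"
    using pos by (simp_all add: p_def q_def Zf_def Zg_def)
  have pf: "integrable M (\<lambda>x. p x * f x)" and pg: "integrable M (\<lambda>x. p x * g x)"
    using f g p_pos by (simp_all add: integrable_real_density less_imp_le)
  have dens: "(LINT x|density M (\<lambda>x. ennreal (p x)). h x) = (LINT x|M. p x * h x)"
    if "h \<in> borel_measurable M" for h :: "'a \<Rightarrow> real"
    using that p_pos by (simp add: integral_real_density less_imp_le)
  \<comment> \<open>Here \<open>r\<close> is the log-ratio \<open>ln (q / p)\<close>.\<close>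
  define r where "r x = (g x - ln Zg) - (f x - ln Zf)" for x
  \<comment> \<open>The gap in \<open>1 + r \<le> exp r\<close>, weighted by \<open>p\<close>. Since
    \<open>p\<close> and \<open>q\<close> both have integral 1, integrating \<open>d\<close> leaves
    only minus the mean of \<open>r\<close> under \<open>p\<close>.\<close>
  define d where "d x = q x - p x - p x * r x" for x
  have q_eq: "q x = p x * exp (r x)" for x
    using pos by (simp add: p_def q_def r_def exp_diff exp_add field_simps)
  have d_eq: "d x = p x * (exp (r x) - 1 - r x)" for x
    by (simp add: d_def q_eq algebra_simps)
  have d_nonneg: "0 \<le> d x" for x
    unfolding d_eq using p_pos[of x] exp_ge_add_one_self[of "r x"]
    by (intro mult_nonneg_nonneg) linarith+
  have pr_eq: "p x * r x = p x * g x - p x * f x + (ln Zf - ln Zg) * p x" for x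
    by (simp add: r_def algebra_simps)
  have pr: "integrable M (\<lambda>x. p x * r x)"
    unfolding pr_eq using p pf pg by simp
  have "(LINT x|M. p x * r x)
      = (LINT x|M. p x * g x) - (LINT x|M. p x * f x) + (ln Zf - ln Zg)"
    unfolding pr_eq using p pf pg int_p by simp
  \<comment> \<open>This is \<open>le\<close> rearranged. It bounds the integral of the nonnegative
    function \<open>d\<close> above by 0, so \<open>d\<close> vanishes almost everywhere.\<close>
  then have "0 \<le> (LINT x|M. p x * r x)"
    using le by (simp add: dens)
  moreover have "integral\<^sup>L M d = - (LINT x|M. p x * r x)"
    unfolding d_def using p q pr int_p int_q by simp
  moreover have "integrable M d"
    unfolding d_def using p q pr by simp
  ultimately have "AE x in M. d x = 0"
    using integral_nonneg_eq_0_iff_AE[of M d] Bochner_Integration.integral_nonneg[of M d] d_nonneg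
    by force
  then show ?thesis
  proof eventually_elim
    case (elim x)
    then have "exp (r x) = 1 + r x"
      using p_pos[of x] by (simp add: d_eq)
    \<comment> \<open>In the form \<open>ln y = y - 1\<close> with \<open>y = exp (r x)\<close>, the
      equation has the single solution \<open>y = 1\<close>.\<close>
    then have "ln (exp (r x)) = exp (r x) - 1"
      unfolding ln_exp by linarith
    then have "exp (r x) = 1"
      by (rule ln_eq_minus_one[OF exp_gt_zero])
    then show "p x = q x"
      by (simp only: q_eq mult_1_right)
  qed
qed

text \<open>With \<open>c = 1 / n\<close> the inner factor becomes the empirical feature mean, the
  expression that the matching hypothesis rewrites.\<close>

lemma sum_score_swap:
  "c * (\<Sum>l\<in>A. sum_score G \<theta> (D l))
    = (\<Sum>i=1..players G. \<Sum>j=1..feat_dim G i.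
        \<theta> i j * (c * (\<Sum>l\<in>A. feature_count G i (D l) j)))"
proof -
  have "(\<Sum>l\<in>A. sum_score G \<theta> (D l))
      = (\<Sum>i=1..players G. \<Sum>j=1..feat_dim G i. \<Sum>l\<in>A. \<theta> i j * feature_count G i (D l) j)"
    unfolding sum_score_def by (subst sum.swap, subst (2) sum.swap) (rule refl)
  then show ?thesis
    by (simp add: sum_distrib_left mult_ac)
qed

text \<open>A positive normalizer makes every factor positive, so the logarithm splits over the
  product. The factor \<open>n\<close> is pulled out to expose the empirical mean score, which
  matching turns into an expectation.\<close>

lemma ln_prod_traj_density:
  assumes "0 < (LINT \<zeta>|traj_measure G. exp (sum_score G \<theta> \<zeta>))" and "1 \<le> n"
  shows "ln (\<Prod>l=1..n. traj_density G \<theta> (D l))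
    = real n * (1 / real n * (\<Sum>l=1..n. sum_score G \<theta> (D l))
        - ln (LINT \<zeta>|traj_measure G. exp (sum_score G \<theta> \<zeta>)))"
proof -
  let ?Z = "LINT \<zeta>|traj_measure G. exp (sum_score G \<theta> \<zeta>)"
  have "ln (\<Prod>l=1..n. traj_density G \<theta> (D l)) = (\<Sum>l=1..n. ln (traj_density G \<theta> (D l)))"
    using assms by (intro ln_prod) (auto simp: traj_density_def)
  also have "\<dots> = (\<Sum>l=1..n. sum_score G \<theta> (D l) - ln ?Z)"
    using assms by (simp add: traj_density_def ln_div)
  finally show ?thesis
    using assms by (simp add: sum_subtractf algebra_simps)
qed

text \<open>The conclusion concerns distributions because affinely dependent features can leave the
  parameters undetermined. Equality of measures also transfers integrability to
  \<open>\<theta>hat\<close>.\<close>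

lemma traj_dist_mle_eq:
  assumes star: "\<theta>star \<in> params G"
    and exp_ex: "\<And>i j. i \<in> {1..players G} \<Longrightarrow> j \<in> {1..feat_dim G i} \<Longrightarrow>
         integrable (traj_dist G \<theta>star) (\<lambda>\<zeta>. feature_count G i \<zeta> j)"
    and n: "1 \<le> n"
    and matching: "\<And>i j. i \<in> {1..players G} \<Longrightarrow> j \<in> {1..feat_dim G i} \<Longrightarrow>
         (LINT \<zeta>|traj_dist G \<theta>star. feature_count G i \<zeta> j)
           = 1 / real n * (\<Sum>l=1..n. feature_count G i (D l) j)"
    and mle: "is_arg_max (\<lambda>\<theta>. ln (\<Prod>l=1..n. traj_density G \<theta> (D l)))
                (\<lambda>\<theta>. \<theta> \<in> params G) \<theta>hat"
  shows "traj_dist G \<theta>hat = traj_dist G \<theta>star"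
proof -
  let ?M = "traj_measure G"
  define Z where "Z \<theta> = (LINT \<zeta>|?M. exp (sum_score G \<theta> \<zeta>))" for \<theta>
  have hat: "\<theta>hat \<in> params G"
    using mle by (simp add: is_arg_max_def)
  have int_exp: "integrable ?M (\<lambda>\<zeta>. exp (sum_score G \<theta> \<zeta>))" if "\<theta> \<in> params G" for \<theta>
    using that by (simp add: params_def)
  have Z_nonneg: "0 \<le> Z \<theta>" for \<theta>
    by (simp add: Z_def)
  have null: "AE \<zeta> in ?M. False" if "\<theta> \<in> params G" "Z \<theta> = 0" for \<theta>
    using that integral_nonneg_eq_0_iff_AE[OF int_exp[OF that(1)]] by (simp add: Z_def)
  show ?thesis
  \<comment> \<open>Degenerate case: an exponential is positive, so a zero normalizer forces a null
    reference measure. Then both normalizers are 0, and division by zero makes both densities the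
    zero function.\<close>
  proof (cases "Z \<theta>star = 0 \<or> Z \<theta>hat = 0")
    case True
    then have "AE \<zeta> in ?M. False"
      using null star hat by blast
    then have "AE \<zeta> in ?M. exp (sum_score G \<theta> \<zeta>) = 0" for \<theta>
      by eventually_elim simp
    then have "Z \<theta>star = 0" "Z \<theta>hat = 0"
      unfolding Z_def by (auto intro!: integral_eq_zero_AE)
    then show ?thesis
      by (simp add: traj_dist_def traj_density_def Z_def)
  next
    case False
    then have Zpos: "0 < Z \<theta>star" "0 < Z \<theta>hat"
      using Z_nonneg[of \<theta>star] Z_nonneg[of \<theta>hat] by simp_all
    have int_score: "integrable (traj_dist G \<theta>star) (sum_score G \<theta>)" for \<theta>
      unfolding sum_score_def[abs_def]
      by (intro Bochner_Integration.integrable_sum integrable_mult_right exp_ex)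
    \<comment> \<open>By linearity, matching of the features extends to the score of every \<theta>,
      always under the distribution of \<open>\<theta>star\<close>.\<close>
    have mean_score: "(LINT \<zeta>|traj_dist G \<theta>star. sum_score G \<theta> \<zeta>)
        = 1 / real n * (\<Sum>l=1..n. sum_score G \<theta> (D l))" for \<theta>
    proof -
      have "(LINT \<zeta>|traj_dist G \<theta>star. sum_score G \<theta> \<zeta>)
          = (\<Sum>i=1..players G. \<Sum>j=1..feat_dim G i.
              \<theta> i j * (LINT \<zeta>|traj_dist G \<theta>star. feature_count G i \<zeta> j))"
        unfolding sum_score_def
        by (subst Bochner_Integration.integral_sum,
            (intro Bochner_Integration.integrable_sum integrable_mult_right exp_ex; assumption),
            intro sum.cong refl, subst Bochner_Integration.integral_sum)
          (auto intro!: integrable_mult_right exp_ex)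
      also have "\<dots> = 1 / real n * (\<Sum>l=1..n. sum_score G \<theta> (D l))"
        unfolding sum_score_swap by (intro sum.cong refl) (simp add: matching)
      finally show ?thesis .
    qed
    \<comment> \<open>Maximality of \<open>\<theta>hat\<close> is tested against the single
      competitor \<open>\<theta>star\<close>. Dividing by \<open>n\<close> then yields hypothesis
      \<open>le\<close> of the Gibbs lemma.\<close>
    have "ln (\<Prod>l=1..n. traj_density G \<theta>star (D l)) \<le> ln (\<Prod>l=1..n. traj_density G \<theta>hat (D l))"
      using mle star by (auto simp: is_arg_max_def not_less)
    then have "(LINT \<zeta>|traj_dist G \<theta>star. sum_score G \<theta>star \<zeta>) - ln (Z \<theta>star)
        \<le> (LINT \<zeta>|traj_dist G \<theta>star. sum_score G \<theta>hat \<zeta>) - ln (Z \<theta>hat)"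
      using n by (simp only: ln_prod_traj_density[OF Zpos(1)[unfolded Z_def] n]
        ln_prod_traj_density[OF Zpos(2)[unfolded Z_def] n] Z_def mean_score) simp
    then have "AE \<zeta> in ?M. traj_density G \<theta>star \<zeta> = traj_density G \<theta>hat \<zeta>"
      using AE_eq_gibbs_density[OF int_exp[OF star] int_exp[OF hat]] Zpos int_score
      by (simp add: traj_density_def[abs_def] traj_dist_def Z_def)
    \<comment> \<open>Measurability is read off from the integrability of the exponential that is
      built into \<open>params\<close>.\<close>
    moreover have "traj_density G \<theta> \<in> borel_measurable ?M" if "\<theta> \<in> params G" for \<theta>
      unfolding traj_density_def[abs_def] using int_exp[OF that]
      by (intro borel_measurable_divide borel_measurable_integrable) auto
    ultimately show ?thesis
      unfolding traj_dist_def using star hat by (intro density_cong) auto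
  qed
qed

theorem theorem1:
  fixes G :: "'n::finite game"
    and \<theta>star \<theta>hat :: "nat \<Rightarrow> nat \<Rightarrow> real"
    and n\<^sub>t :: nat
    and D :: "nat \<Rightarrow> 'n trajectory"
  assumes game: "dynamic_game G"
    and star: "\<theta>star \<in> params G"
    and expectations_exist:
      "\<And>i j. i \<in> {1..players G} \<Longrightarrow> j \<in> {1..feat_dim G i} \<Longrightarrow>
         integrable (traj_dist G \<theta>star) (\<lambda>\<zeta>. feature_count G i \<zeta> j)"
    and data: "1 \<le> n\<^sub>t" "\<And>l. l \<in> {1..n\<^sub>t} \<Longrightarrow> feasible G (D l)"
    and matching:
      "\<And>i j. i \<in> {1..players G} \<Longrightarrow> j \<in> {1..feat_dim G i} \<Longrightarrow>
         (LINT \<zeta>|traj_dist G \<theta>star. feature_count G i \<zeta> j)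
           = 1 / real n\<^sub>t * (\<Sum>l=1..n\<^sub>t. feature_count G i (D l) j)"
    and mle: "is_arg_max (\<lambda>\<theta>. ln (\<Prod>l=1..n\<^sub>t. traj_density G \<theta> (D l)))
                (\<lambda>\<theta>. \<theta> \<in> params G) \<theta>hat"
  shows "integrable (traj_dist G \<theta>hat) (\<lambda>\<zeta>. sum_cost G \<zeta> \<theta>star)
    \<and> (LINT \<zeta>|traj_dist G \<theta>star. sum_cost G \<zeta> \<theta>star)
      = (LINT \<zeta>|traj_dist G \<theta>hat. sum_cost G \<zeta> \<theta>star)"
proof -
  have "integrable (traj_dist G \<theta>star) (\<lambda>\<zeta>. sum_cost G \<zeta> \<theta>star)"
    unfolding sum_cost_eq sum_score_def
    by (intro integrable_minus Bochner_Integration.integrable_sum integrable_mult_right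
        expectations_exist)
  \<comment> \<open>Both claims about \<open>\<theta>hat\<close> reduce to
    \<open>\<theta>star\<close>, where the expectations exist by hypothesis.\<close>
  moreover have "traj_dist G \<theta>hat = traj_dist G \<theta>star"
    using star expectations_exist data(1) matching mle by (rule traj_dist_mle_eq)
  ultimately show ?thesis
    by simp
qed

end
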